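(* Let $\Gamma\subset SL_2(\mathbb R)$ be a Fuchsian group of the first kind and let $m\ge1$. Then, for any sequence $f_1,\ldots,f_k\in M_m(\Gamma)$, the Wronskian $$W(f_1,\ldots,f_k)(z)=\left|\begin{matrix} f_1(z)&\cdots&f_k(z)\\ \frac{df_1(z)}{dz}&\cdots&\frac{df_k(z)}{dz}\\ &\cdots&\\ \frac{d^{k-1}f_1(z)}{dz^{k-1}}&\cdots&\frac{d^{k-1}f_k(z)}{dz^{k-1}}\end{matrix}\right|$$ is a cuspidal modular form in $S_{k(m+k-1)}(\Gamma)$ if $k\ge2$. If $f_1,\ldots,f_k$ are linearly independent, then $W(f_1,\ldots,f_k)\ne0$.
   Context: A Fuchsian group of the first kind is a discrete subgroup $\Gamma\subset SL_2(\mathbb R)$ with $\iint_{\Gamma\backslash\mathbb H} dx\,dy/y^2<\infty$, where $\mathbb H$ is the upper half-plane. For $g=\begin{pmatrix}a&b\\c&d\end{pmatrix}\in SL_2(\mathbb R)$ put $j(g,z)=cz+d$. $M_m(\Gamma)$ (resp. $S_m(\Gamma)$) is the space of holomorphic $f:\mathbb H\to\mathbb C$ with $f(\gamma.z)=j(\gamma,z)^m f(z)$ for all $\gamma\in\Gamma$, $z\in\mathbb H$, that are holomorphic (resp. holomorphic and vanishing) at every cusp of $\Gamma$. *)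

theory Defs
  imports "HOL-Complex_Analysis.Complex_Analysis" "Jordan_Normal_Form.Determinant"
begin

(* HOL-Analysis matrices (real^2^2, with their topology) carry SL_2(R); Jordan_Normal_Form
   matrices are used only for the Wronskian, whose size k is a variable. *)
no_notation vec_index (infixl "$" 100)
hide_const (open) Matrix.mat Matrix.vec Determinant.det

definition SL2R :: "(real^2^2) monoid" where
  "SL2R = \<lparr>carrier = {A. Determinants.det A = 1}, mult = (**), one = mat 1\<rparr>"

lemma group_SL2R: "group SL2R"
proof (rule groupI)
  fix x assume "x \<in> carrier SL2R"
  then have d: "Determinants.det x = 1" by (simp add: SL2R_def)
  then have "invertible x" by (simp add: invertible_det_nz)
  then have l: "matrix_inv x ** x = mat 1"
    unfolding invertible_def matrix_inv_def by (rule someI2_ex) simp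
  then have "Determinants.det (matrix_inv x ** x) = 1" by simp
  then have "Determinants.det (matrix_inv x) = 1" using d by (simp add: Determinants.det_mul)
  with l show "\<exists>y\<in>carrier SL2R. y \<otimes>\<^bsub>SL2R\<^esub> x = \<one>\<^bsub>SL2R\<^esub>"
    by (intro bexI[of _ "matrix_inv x"]) (simp_all add: SL2R_def)
qed (simp_all add: SL2R_def Determinants.det_mul matrix_mul_assoc)

definition upper_half_plane :: "complex set" (\<open>\<H>\<close>) where
  "\<H> = {z. Im z > 0}"

definition moebius :: "real^2^2 \<Rightarrow> complex \<Rightarrow> complex" where
  "moebius g z = (of_real (g$1$1) * z + of_real (g$1$2)) / (of_real (g$2$1) * z + of_real (g$2$2))"

definition autj :: "real^2^2 \<Rightarrow> complex \<Rightarrow> complex" where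
  "autj g z = of_real (g$2$1) * z + of_real (g$2$2)"

definition hyperbolic_area :: "complex set \<Rightarrow> ennreal" where
  "hyperbolic_area F = (\<integral>\<^sup>+z\<in>F. ennreal (1 / (Im z)\<^sup>2) \<partial>lborel)"

(* A measurable exact set of representatives for the orbits. The integral over the quotient
   by Gamma is the integral over such a set and does not depend on the choice. *)
definition fundamental_set :: "(real^2^2) set \<Rightarrow> complex set \<Rightarrow> bool" where
  "fundamental_set \<Gamma> F \<longleftrightarrow> F \<in> sets borel \<and> F \<subseteq> \<H> \<and>
     (\<forall>z\<in>\<H>. \<exists>!w. w \<in> F \<and> (\<exists>\<gamma>\<in>\<Gamma>. w = moebius \<gamma> z))"

definition fuchsian_first_kind :: "(real^2^2) set \<Rightarrow> bool" where
  "fuchsian_first_kind \<Gamma> \<longleftrightarrow> subgroup \<Gamma> SL2R \<and> discrete \<Gamma> \<and>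
     (\<exists>F. fundamental_set \<Gamma> F \<and> hyperbolic_area F < \<infinity>)"

(* The action on the boundary of the half-plane; None stands for the point at infinity. *)
fun boundary_act :: "real^2^2 \<Rightarrow> real option \<Rightarrow> real option" where
  "boundary_act g None = (if g$2$1 = 0 then None else Some (g$1$1 / g$2$1))"
| "boundary_act g (Some x) =
     (if g$2$1 * x + g$2$2 = 0 then None
      else Some ((g$1$1 * x + g$1$2) / (g$2$1 * x + g$2$2)))"

definition parabolic :: "real^2^2 \<Rightarrow> bool" where
  "parabolic g \<longleftrightarrow> g \<in> carrier SL2R \<and> \<bar>trace g\<bar> = 2 \<and>
     g \<noteq> mat 1 \<and> g \<noteq> - mat 1"

definition cusp :: "(real^2^2) set \<Rightarrow> real option \<Rightarrow> bool" where
  "cusp \<Gamma> x \<longleftrightarrow> (\<exists>\<gamma>\<in>\<Gamma>. parabolic \<gamma> \<and> boundary_act \<gamma> x = x)"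

definition translation :: "real \<Rightarrow> real^2^2" where
  "translation h = vector [vector [1, h], vector [0, 1]]"

definition slash :: "nat \<Rightarrow> (complex \<Rightarrow> complex) \<Rightarrow> real^2^2 \<Rightarrow> complex \<Rightarrow> complex" where
  "slash m f \<sigma> z = f (moebius \<sigma> z) / autj \<sigma> z ^ m"

(* \<sigma> moves infinity to x, and translation by h > 0, conjugated by \<sigma>, is an element of
   the stabilizer of x in Gamma. For modular f the function f | \<sigma> then has period h exactly,
   without a sign, also if m is odd and the cusp is irregular (only minus the translation by
   the width lies in the conjugated group); in that case the smallest such h is twice the width. *)
definition cusp_chart :: "(real^2^2) set \<Rightarrow> real option \<Rightarrow> real^2^2 \<Rightarrow> real \<Rightarrow> bool" where
  "cusp_chart \<Gamma> x \<sigma> h \<longleftrightarrow> \<sigma> \<in> carrier SL2R \<and> boundary_act \<sigma> None = x \<and> h > 0 \<and>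
     \<sigma> ** translation h ** matrix_inv \<sigma> \<in> \<Gamma>"

(* g is the Fourier expansion of F in the local parameter q = exp (2 pi i z / h), including
   its value at q = 0. *)
definition q_expansion :: "(complex \<Rightarrow> complex) \<Rightarrow> real \<Rightarrow> (complex \<Rightarrow> complex) \<Rightarrow> bool" where
  "q_expansion F h g \<longleftrightarrow> g holomorphic_on ball 0 1 \<and>
     (\<forall>z\<in>\<H>. F z = g (exp (2 * of_real pi * \<i> * z / of_real h)))"

definition holomorphic_at_cusp ::
    "(real^2^2) set \<Rightarrow> nat \<Rightarrow> (complex \<Rightarrow> complex) \<Rightarrow> real option \<Rightarrow> bool" where
  "holomorphic_at_cusp \<Gamma> m f x \<longleftrightarrow>
     (\<forall>\<sigma> h. cusp_chart \<Gamma> x \<sigma> h \<longrightarrow> (\<exists>g. q_expansion (slash m f \<sigma>) h g))"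

definition vanishes_at_cusp ::
    "(real^2^2) set \<Rightarrow> nat \<Rightarrow> (complex \<Rightarrow> complex) \<Rightarrow> real option \<Rightarrow> bool" where
  "vanishes_at_cusp \<Gamma> m f x \<longleftrightarrow>
     (\<forall>\<sigma> h. cusp_chart \<Gamma> x \<sigma> h \<longrightarrow> (\<exists>g. q_expansion (slash m f \<sigma>) h g \<and> g 0 = 0))"

(* Functions on the half-plane are total functions on the complex numbers whose values
   elsewhere are irrelevant. *)
definition modular_forms :: "nat \<Rightarrow> (real^2^2) set \<Rightarrow> (complex \<Rightarrow> complex) set" where
  "modular_forms m \<Gamma> = {f. f holomorphic_on \<H> \<and>
     (\<forall>\<gamma>\<in>\<Gamma>. \<forall>z\<in>\<H>. f (moebius \<gamma> z) = autj \<gamma> z ^ m * f z) \<and>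
     (\<forall>x. cusp \<Gamma> x \<longrightarrow> holomorphic_at_cusp \<Gamma> m f x)}"

definition cusp_forms :: "nat \<Rightarrow> (real^2^2) set \<Rightarrow> (complex \<Rightarrow> complex) set" where
  "cusp_forms m \<Gamma> = {f \<in> modular_forms m \<Gamma>. \<forall>x. cusp \<Gamma> x \<longrightarrow> vanishes_at_cusp \<Gamma> m f x}"

(* The sequence is indexed from 0; column j belongs to f j. *)
definition wronskian :: "nat \<Rightarrow> (nat \<Rightarrow> complex \<Rightarrow> complex) \<Rightarrow> complex \<Rightarrow> complex" where
  "wronskian k f z = Determinant.det (Matrix.mat k k (\<lambda>(i, j). (deriv ^^ i) (f j) z))"

definition lin_indep_on :: "complex set \<Rightarrow> nat \<Rightarrow> (nat \<Rightarrow> complex \<Rightarrow> complex) \<Rightarrow> bool" where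
  "lin_indep_on A k f \<longleftrightarrow>
     (\<forall>c :: nat \<Rightarrow> complex. (\<forall>z\<in>A. (\<Sum>j<k. c j * f j z) = 0) \<longrightarrow> (\<forall>j<k. c j = 0))"

end

theory Submission
  imports Defs
begin

text \<open>
  Write \<open>f |\<^sub>m \<sigma>\<close> for the slash action of weight \<open>m\<close>. Differentiating \<open>u \<cdot> (f \<circ> \<phi>)\<close> repeatedly
  gives combinations of the \<open>f\<^sup>(\<^sup>l\<^sup>) \<circ> \<phi>\<close> with coefficients independent of \<open>f\<close> that form a
  triangular matrix with diagonal entries \<open>u \<phi>'\<^sup>i\<close>. So, up to the product of these entries,
  the Wronskian commutes with such a substitution (\<open>wronskian_mult_compose\<close>). All parts of the
  theorem rest on two instances of this identity.

  With \<open>\<phi>\<close> a Moebius transformation and \<open>u\<close> its factor of automorphy to the power \<open>-m\<close> it says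
  that the Wronskian of the \<open>f\<^sub>j |\<^sub>m \<sigma>\<close> is the Wronskian of the \<open>f\<^sub>j\<close> slashed by \<open>\<sigma>\<close> in weight
  \<open>k (m + k - 1)\<close> (\<open>slash_wronskian\<close>). For \<open>\<sigma> \<in> \<Gamma>\<close> this is modularity. For \<open>\<sigma>\<close> moving infinity to
  a cusp it reduces the claim there to periodic functions with an expansion in
  \<open>q = exp (2 \<pi> i z / h)\<close>. On these \<open>d/dz\<close> acts as a multiple of \<open>q d/dq\<close>, which produces a factor
  \<open>q\<close>; every row of the Wronskian below the first therefore vanishes at \<open>q = 0\<close>, and so does
  the determinant once there is such a row (\<open>q_expansion_wronskian\<close>).

  With \<open>\<phi>\<close> the identity and \<open>u = f\<^sub>0\<close> it allows division by \<open>f\<^sub>0\<close>, which lowers the number of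
  functions by one and shows inductively that holomorphic functions on a domain whose Wronskian
  is identically zero are linearly dependent (\<open>wronskian_nonzero_if_lin_indep\<close>).
\<close>

section \<open>Wronskians of holomorphic functions\<close>

lemma det_holomorphic:
  assumes "\<And>i j. i < n \<Longrightarrow> j < n \<Longrightarrow> A i j holomorphic_on S"
  shows "(\<lambda>z. Determinant.det (Matrix.mat n n (\<lambda>(i, j). A i j z))) holomorphic_on S"
proof -
  have "(\<lambda>z. Determinant.det (Matrix.mat n n (\<lambda>(i, j). A i j z))) =
      (\<lambda>z. \<Sum>p | p permutes {0..<n}. signof p * (\<Prod>i=0..<n. A i (p i) z))"
  proof
    fix z
    show "Determinant.det (Matrix.mat n n (\<lambda>(i, j). A i j z)) =
      (\<Sum>p | p permutes {0..<n}. signof p * (\<Prod>i=0..<n. A i (p i) z))"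
      by (subst Determinant.det_def'[of _ n])
        (auto intro!: sum.cong prod.cong simp: permutes_in_image)
  qed
  moreover have "A i (p i) holomorphic_on S" if "p permutes {0..<n}" "i \<in> {0..<n}" for p i
    using that assms permutes_in_image[OF that(1), of i] by auto
  ultimately show ?thesis
    by (auto intro!: holomorphic_intros)
qed

lemma wronskian_holomorphic:
  assumes "open S" "\<And>j. j < k \<Longrightarrow> f j holomorphic_on S"
  shows "wronskian k f holomorphic_on S"
  unfolding wronskian_def[abs_def]
  by (rule det_holomorphic) (auto intro!: holomorphic_higher_deriv assms)

lemma wronskian_cong:
  assumes "open S" "z \<in> S" "\<And>j. j < k \<Longrightarrow> f j holomorphic_on S"
    and "\<And>j w. j < k \<Longrightarrow> w \<in> S \<Longrightarrow> f j w = g j w"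
  shows "wronskian k f z = wronskian k g z"
proof -
  have "(deriv ^^ i) (f j) z = (deriv ^^ i) (g j) z" if "j < k" for i j
  proof (rule higher_deriv_transform_within_open)
    show "g j holomorphic_on S"
      using assms(3)[OF that] by (rule holomorphic_transform) (use assms(4) that in auto)
  qed (use assms that in auto)
  then show ?thesis
    unfolding wronskian_def by (intro arg_cong[of _ _ Determinant.det] cong_mat) auto
qed

section \<open>Change of variable\<close>

text \<open>By the chain rule the \<open>i\<close>-th derivative of \<open>u \<cdot> (f \<circ> \<phi>)\<close> is a linear combination of the
  functions \<open>f\<^sup>(\<^sup>l\<^sup>) \<circ> \<phi>\<close>, \<open>l \<le> i\<close>, whose coefficients depend on \<open>u\<close> and \<open>\<phi>\<close> but not on \<open>f\<close>.
  These are the coefficients. A recursion replaces the formula of Faa di Bruno, since only the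
  triangular shape and the diagonal are of interest.\<close>

primrec chain_coeff ::
    "(complex \<Rightarrow> complex) \<Rightarrow> (complex \<Rightarrow> complex) \<Rightarrow> nat \<Rightarrow> nat \<Rightarrow> complex \<Rightarrow> complex" where
  "chain_coeff u \<phi> 0 = (\<lambda>l z. if l = 0 then u z else 0)"
| "chain_coeff u \<phi> (Suc i) = (\<lambda>l z. deriv (chain_coeff u \<phi> i l) z +
     (if l = 0 then 0 else chain_coeff u \<phi> i (l - 1) z * deriv \<phi> z))"

lemma chain_coeff_above_diagonal: "i < l \<Longrightarrow> chain_coeff u \<phi> i l = (\<lambda>z. 0)"
  by (induction i arbitrary: l) auto

lemma chain_coeff_diagonal: "chain_coeff u \<phi> i i z = u z * deriv \<phi> z ^ i"
  by (induction i) (simp_all add: chain_coeff_above_diagonal)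

lemma chain_coeff_holomorphic:
  assumes "open S" "u holomorphic_on S" "\<phi> holomorphic_on S"
  shows "chain_coeff u \<phi> i l holomorphic_on S"
proof (induction i arbitrary: l)
  case 0
  then show ?case using assms by (cases l) auto
next
  case (Suc i)
  then show ?case using assms by (cases l) (auto intro!: holomorphic_intros)
qed

lemma higher_deriv_mult_compose:
  assumes S: "open S" and T: "open T" and u: "u holomorphic_on S" and phi: "\<phi> holomorphic_on S"
    and ST: "\<phi> ` S \<subseteq> T" and f: "f holomorphic_on T" and z: "z \<in> S"
  shows "(deriv ^^ i) (\<lambda>z. u z * f (\<phi> z)) z =
    (\<Sum>l\<le>i. chain_coeff u \<phi> i l z * (deriv ^^ l) f (\<phi> z))"
  using z
proof (induction i arbitrary: z)
  case 0
  then show ?case by simp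
next
  case (Suc i)
  let ?a = "chain_coeff u \<phi>"
  have a: "(?a i l has_field_derivative deriv (?a i l) z) (at z)" for l
    using chain_coeff_holomorphic[OF S u phi] S Suc.prems by (rule holomorphic_derivI)
  have p: "(\<phi> has_field_derivative deriv \<phi> z) (at z)"
    using phi S Suc.prems by (rule holomorphic_derivI)
  have d: "((\<lambda>w. (deriv ^^ l) f (\<phi> w)) has_field_derivative
      (deriv ^^ Suc l) f (\<phi> z) * deriv \<phi> z) (at z)" for l
    using ST Suc.prems
    by (intro DERIV_chain2[OF has_field_derivative_higher_deriv[OF f T] p]) auto
  have "((\<lambda>w. \<Sum>l\<le>i. ?a i l w * (deriv ^^ l) f (\<phi> w)) has_field_derivative
      (\<Sum>l\<le>i. deriv (?a i l) z * (deriv ^^ l) f (\<phi> z) +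
        (deriv ^^ Suc l) f (\<phi> z) * deriv \<phi> z * ?a i l z)) (at z)"
    by (intro DERIV_sum DERIV_mult a d)
  then have "((deriv ^^ i) (\<lambda>z. u z * f (\<phi> z)) has_field_derivative
      (\<Sum>l\<le>i. deriv (?a i l) z * (deriv ^^ l) f (\<phi> z) +
        (deriv ^^ Suc l) f (\<phi> z) * deriv \<phi> z * ?a i l z)) (at z)"
    by (rule has_field_derivative_transform_within_open[OF _ S Suc.prems])
      (simp add: Suc.IH)
  then have "(deriv ^^ Suc i) (\<lambda>z. u z * f (\<phi> z)) z =
      (\<Sum>l\<le>i. deriv (?a i l) z * (deriv ^^ l) f (\<phi> z)) +
      (\<Sum>l\<le>i. ?a i l z * deriv \<phi> z * (deriv ^^ Suc l) f (\<phi> z))"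
    by (simp add: DERIV_imp_deriv sum.distrib mult_ac)
  also have "(\<Sum>l\<le>i. deriv (?a i l) z * (deriv ^^ l) f (\<phi> z)) =
      (\<Sum>l\<le>Suc i. deriv (?a i l) z * (deriv ^^ l) f (\<phi> z))"
    by (simp add: chain_coeff_above_diagonal)
  also have "(\<Sum>l\<le>i. ?a i l z * deriv \<phi> z * (deriv ^^ Suc l) f (\<phi> z)) =
      (\<Sum>l\<le>Suc i. (if l = 0 then 0 else ?a i (l - 1) z * deriv \<phi> z) * (deriv ^^ l) f (\<phi> z))"
    by (simp add: sum.atMost_Suc_shift del: sum.atMost_Suc funpow.simps)
  finally show ?case
    by (simp add: sum.distrib[symmetric] distrib_right del: sum.atMost_Suc funpow.simps)
qed

text \<open>The Wronskian matrix of the functions \<open>u \<cdot> (f\<^sub>j \<circ> \<phi>)\<close> is that of the \<open>f\<^sub>j\<close> at \<open>\<phi> z\<close>,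
  multiplied from the left by the lower triangular matrix of chain rule coefficients, so only the
  diagonal of the latter enters the determinant.\<close>

lemma wronskian_mult_compose:
  assumes S: "open S" and T: "open T" and u: "u holomorphic_on S" and phi: "\<phi> holomorphic_on S"
    and ST: "\<phi> ` S \<subseteq> T" and f: "\<And>j. j < k \<Longrightarrow> f j holomorphic_on T" and z: "z \<in> S"
  shows "wronskian k (\<lambda>j z. u z * f j (\<phi> z)) z =
    (\<Prod>i<k. u z * deriv \<phi> z ^ i) * wronskian k f (\<phi> z)"
proof -
  let ?A = "Matrix.mat k k (\<lambda>(i, l). chain_coeff u \<phi> i l z)"
  let ?W = "Matrix.mat k k (\<lambda>(l, j). (deriv ^^ l) (f j) (\<phi> z))"
  have "Matrix.mat k k (\<lambda>(i, j). (deriv ^^ i) (\<lambda>z. u z * f j (\<phi> z)) z) = ?A * ?W"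
  proof (rule eq_matI)
    fix i j assume "i < dim_row (?A * ?W)" "j < dim_col (?A * ?W)"
    then have ij: "i < k" "j < k" by auto
    have "(\<Sum>l\<le>i. chain_coeff u \<phi> i l z * (deriv ^^ l) (f j) (\<phi> z)) =
        (\<Sum>l=0..<k. chain_coeff u \<phi> i l z * (deriv ^^ l) (f j) (\<phi> z))"
      using ij by (intro sum.mono_neutral_left) (auto simp: chain_coeff_above_diagonal)
    with ij show "Matrix.mat k k (\<lambda>(i, j). (deriv ^^ i) (\<lambda>z. u z * f j (\<phi> z)) z) $$ (i, j) =
        (?A * ?W) $$ (i, j)"
      by (simp add: higher_deriv_mult_compose[OF S T u phi ST f z] scalar_prod_def)
  qed auto
  then have "wronskian k (\<lambda>j z. u z * f j (\<phi> z)) z =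
      Determinant.det ?A * Determinant.det ?W"
    unfolding wronskian_def by (simp add: Determinant.det_mult[of _ k])
  also have "Determinant.det ?A = prod_list (diag_mat ?A)"
    by (rule Determinant.det_lower_triangular[of k]) (auto simp: chain_coeff_above_diagonal)
  also have "\<dots> = (\<Prod>i<k. u z * deriv \<phi> z ^ i)"
    by (simp add: prod_list_diag_prod chain_coeff_diagonal atLeast0LessThan)
  finally show ?thesis by (simp add: wronskian_def)
qed

section \<open>Vanishing Wronskian and linear dependence\<close>

text \<open>Expansion along the column of the constant function \<open>1\<close>, in which only the top entry
  survives.\<close>

lemma wronskian_first_const_1:
  assumes S: "open S" "z \<in> S" and g: "\<And>w. w \<in> S \<Longrightarrow> g 0 w = 1"
  shows "wronskian (Suc k) g z = wronskian k (\<lambda>j. deriv (g (Suc j))) z"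
proof -
  let ?M = "Matrix.mat (Suc k) (Suc k) (\<lambda>(i, j). (deriv ^^ i) (g j) z)"
  have "(deriv ^^ i) (g 0) z = (deriv ^^ i) (\<lambda>w. 1) z" for i
  proof (rule higher_deriv_transform_within_open)
    show "g 0 holomorphic_on S"
      by (rule holomorphic_transform[of "\<lambda>w. 1"]) (auto simp: g)
  qed (use S g in auto)
  then have col: "(deriv ^^ i) (g 0) z = (if i = 0 then 1 else 0)" for i
    by simp
  have "wronskian (Suc k) g z = (\<Sum>i<Suc k. ?M $$ (i, 0) * cofactor ?M i 0)"
    unfolding wronskian_def by (rule laplace_expansion_column) auto
  also have "\<dots> = (\<Sum>i<Suc k. if i = 0 then cofactor ?M i 0 else 0)"
    by (intro sum.cong refl) (simp add: col)
  also have "\<dots> = Determinant.det (mat_delete ?M 0 0)"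
    by (simp add: cofactor_def)
  also have "mat_delete ?M 0 0 =
      Matrix.mat k k (\<lambda>(i, j). (deriv ^^ i) (deriv (g (Suc j))) z)"
    by (rule eq_matI) (auto simp: mat_delete_def funpow_Suc_right simp del: funpow.simps)
  finally show ?thesis by (simp add: wronskian_def)
qed

text \<open>Dividing by \<open>f\<^sub>0\<close> on a ball without zeros of it makes the first function \<open>1\<close> and multiplies
  the Wronskian by a nowhere zero function; what remains is the Wronskian of the derivatives
  \<open>(f\<^sub>j / f\<^sub>0)'\<close>, one function fewer. A linear relation between these integrates to one between the
  \<open>f\<^sub>j / f\<^sub>0\<close> and \<open>1\<close>, which spreads from the ball to the whole domain by analytic
  continuation. Real differentiability would not do: \<open>x\<^sup>2\<close> and \<open>x\<bar>x\<bar>\<close> are independent on the real line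
  with Wronskian zero.\<close>

lemma wronskian_nonzero_if_lin_indep:
  assumes "open S" "connected S" "S \<noteq> {}" "\<And>j. j < k \<Longrightarrow> f j holomorphic_on S"
    and "lin_indep_on S k f"
  shows "\<exists>z\<in>S. wronskian k f z \<noteq> 0"
  using assms
proof (induction k arbitrary: S f)
  case 0
  then show ?case by (auto simp: wronskian_def)
next
  case (Suc k)
  have hf: "f j holomorphic_on S" if "j \<le> k" for j
    using Suc.prems(4) that by simp
  show ?case
  proof (rule ccontr)
    assume "\<not> ?thesis"
    then have W0: "wronskian (Suc k) f z = 0" if "z \<in> S" for z
      using that by blast
    have "\<exists>w\<in>S. f 0 w \<noteq> 0"
    proof (rule ccontr)
      assume "\<not> ?thesis"
      then have "\<forall>z\<in>S. (\<Sum>j<Suc k. (if j = 0 then 1 else 0) * f j z) = 0"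
        by (auto intro!: sum.neutral)
      then have "\<forall>j<Suc k. (if j = 0 then 1 else 0) = (0 :: complex)"
        by (rule Suc.prems(5)[unfolded lin_indep_on_def, 
            THEN spec[of _ "\<lambda>j. if j = 0 then 1 else 0"], THEN mp])
      then show False by auto
    qed
    then obtain w where w: "w \<in> S" "f 0 w \<noteq> 0" by blast
    have "open {z \<in> S. f 0 z \<noteq> 0}"
    proof -
      have "open (S \<inter> f 0 -` (- {0}))"
        using hf[of 0] Suc.prems(1)
        by (intro continuous_open_preimage holomorphic_on_imp_continuous_on) auto
      moreover have "S \<inter> f 0 -` (- {0}) = {z \<in> S. f 0 z \<noteq> 0}" by auto
      ultimately show ?thesis by simp
    qed
    then obtain r where r: "r > 0" "ball w r \<subseteq> {z \<in> S. f 0 z \<noteq> 0}"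
      using w by (metis (mono_tags, lifting) mem_Collect_eq openE)
    define B where "B = ball w r"
    have B: "open B" "connected B" "B \<noteq> {}" "w \<in> B" "B \<subseteq> S"
      and f0: "\<And>z. z \<in> B \<Longrightarrow> f 0 z \<noteq> 0"
      using r by (auto simp: B_def)
    define g where "g = (\<lambda>j z. f j z / f 0 z)"
    have hfB: "f j holomorphic_on B" if "j \<le> k" for j
      using hf[OF that] B(5) by (rule holomorphic_on_subset)
    have hg: "g j holomorphic_on B" if "j \<le> k" for j
      unfolding g_def using f0 by (intro holomorphic_intros hfB that) auto
    have "wronskian k (\<lambda>j. deriv (g (Suc j))) z = 0" if z: "z \<in> B" for z
    proof -
      have "0 = wronskian (Suc k) f z"
        using W0 z B(5) by auto
      also have "\<dots> = wronskian (Suc k) (\<lambda>j z. f 0 z * g j z) z"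
        by (rule wronskian_cong[OF B(1) z]) (auto intro!: hfB simp: g_def f0)
      also have "\<dots> = (\<Prod>i<Suc k. f 0 z * deriv (\<lambda>z. z) z ^ i) * wronskian (Suc k) g z"
        using wronskian_mult_compose[OF B(1) B(1) hfB[of 0] holomorphic_on_ident,
            of "Suc k" g z] hg z by simp
      also have "wronskian (Suc k) g z = wronskian k (\<lambda>j. deriv (g (Suc j))) z"
        by (rule wronskian_first_const_1[OF B(1) z]) (simp add: g_def f0)
      finally show ?thesis using f0[OF z] by simp
    qed
    moreover have "deriv (g (Suc j)) holomorphic_on B" if "j < k" for j
      using that by (intro holomorphic_deriv hg B) auto
    ultimately have "\<not> lin_indep_on B k (\<lambda>j. deriv (g (Suc j)))"
      using Suc.IH[OF B(1-3), of "\<lambda>j. deriv (g (Suc j))"] by blast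
    then obtain c j0 where c: "\<And>z. z \<in> B \<Longrightarrow> (\<Sum>j<k. c j * deriv (g (Suc j)) z) = 0"
      and j0: "j0 < k" "c j0 \<noteq> 0"
      unfolding lin_indep_on_def by blast
    have "((\<lambda>z. \<Sum>j<k. c j * g (Suc j) z) has_field_derivative 0) (at z)" if z: "z \<in> B" for z
    proof -
      have "((\<lambda>z. \<Sum>j<k. c j * g (Suc j) z) has_field_derivative
          (\<Sum>j<k. c j * deriv (g (Suc j)) z)) (at z)"
        by (intro DERIV_sum DERIV_cmult holomorphic_derivI[OF hg B(1) z]) auto
      then show ?thesis using c[OF z] by simp
    qed
    then have "(\<lambda>z. \<Sum>j<k. c j * g (Suc j) z) constant_on B"
      using B by (intro has_field_derivative_0_imp_constant_on)
    then obtain C where C: "\<And>z. z \<in> B \<Longrightarrow> (\<Sum>j<k. c j * g (Suc j) z) = C"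
      unfolding constant_on_def by blast
    \<comment> \<open>The relation \<open>\<Sum> c\<^sub>j f\<^sub>j\<^sub>+\<^sub>1 / f\<^sub>0 = C\<close>, multiplied by \<open>f\<^sub>0\<close>.\<close>
    define d where "d = case_nat (- C) c"
    have relB: "(\<Sum>j<Suc k. d j * f j z) = 0" if z: "z \<in> B" for z
    proof -
      have "(\<Sum>j<Suc k. d j * f j z) = - C * f 0 z + (\<Sum>j<k. c j * f (Suc j) z)"
        by (simp add: sum.lessThan_Suc_shift d_def del: sum.lessThan_Suc)
      also have "(\<Sum>j<k. c j * f (Suc j) z) = (\<Sum>j<k. c j * g (Suc j) z) * f 0 z"
        unfolding sum_distrib_right by (intro sum.cong refl) (simp add: g_def f0 z)
      finally show ?thesis using C[OF z] by simp
    qed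
    have "(\<Sum>j<Suc k. d j * f j z) = 0" if z: "z \<in> S" for z
    proof (rule analytic_continuation_open[where s = B and s' = S and g = "\<lambda>_. 0"
          and f = "\<lambda>z. \<Sum>j<Suc k. d j * f j z"])
      show "(\<lambda>z. \<Sum>j<Suc k. d j * f j z) holomorphic_on S"
        by (intro holomorphic_intros hf) auto
    qed (use B Suc.prems z relB in auto)
    then have "\<forall>j<Suc k. d j = 0"
      using Suc.prems(5) unfolding lin_indep_on_def by blast
    then have "d (Suc j0) = 0" using j0 by blast
    then show False using j0 by (simp add: d_def)
  qed
qed

section \<open>The action on the upper half-plane\<close>

lemma open_upper_half_plane: "open \<H>"
  unfolding upper_half_plane_def by (rule open_halfspace_Im_gt)

lemma connected_upper_half_plane: "connected \<H>"
  unfolding upper_half_plane_def by (intro convex_connected convex_halfspace_Im_gt)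

lemma carrier_SL2R_iff:
  "g \<in> carrier SL2R \<longleftrightarrow> g $ 1 $ 1 * g $ 2 $ 2 - g $ 1 $ 2 * g $ 2 $ 1 = 1"
  by (simp add: SL2R_def det_2)

lemma autj_nonzero:
  assumes "g \<in> carrier SL2R" "z \<in> \<H>"
  shows "autj g z \<noteq> 0"
proof
  assume "autj g z = 0"
  then have "g $ 2 $ 1 * Im z = 0" "g $ 2 $ 1 * Re z + g $ 2 $ 2 = 0"
    by (auto simp: autj_def complex_eq_iff)
  with assms show False
    by (auto simp: carrier_SL2R_iff upper_half_plane_def)
qed

lemma moebius_upper_half_plane:
  assumes "g \<in> carrier SL2R" "z \<in> \<H>"
  shows "moebius g z \<in> \<H>"
proof -
  let ?n = "of_real (g $ 1 $ 1) * z + of_real (g $ 1 $ 2)"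
  have "Im (?n * cnj (autj g z)) =
      (g $ 1 $ 1 * g $ 2 $ 2 - g $ 1 $ 2 * g $ 2 $ 1) * Im z"
    by (simp add: autj_def algebra_simps)
  then have "Im (?n * cnj (autj g z)) = Im z"
    using assms(1) by (simp add: carrier_SL2R_iff)
  moreover have "moebius g z = (?n * cnj (autj g z)) / of_real ((cmod (autj g z))\<^sup>2)"
    using autj_nonzero[OF assms] unfolding moebius_def autj_def[symmetric]
    by (subst complex_div_cnj) simp
  ultimately have "Im (moebius g z) = Im z / (cmod (autj g z))\<^sup>2"
    by (simp only: Im_divide_of_real)
  then show ?thesis
    using assms autj_nonzero[OF assms] by (simp add: upper_half_plane_def)
qed

lemma moebius_has_field_derivative:
  assumes "g \<in> carrier SL2R" "z \<in> \<H>"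
  shows "(moebius g has_field_derivative 1 / autj g z ^ 2) (at z)"
proof -
  have nz: "of_real (g $ 2 $ 1) * z + of_real (g $ 2 $ 2) \<noteq> 0"
    using autj_nonzero[OF assms] by (simp add: autj_def)
  have "complex_of_real (g $ 1 $ 1 * g $ 2 $ 2 - g $ 1 $ 2 * g $ 2 $ 1) = 1"
    using assms(1) by (simp add: carrier_SL2R_iff)
  then have "of_real (g $ 1 $ 1) * (of_real (g $ 2 $ 1) * z + of_real (g $ 2 $ 2)) -
      (of_real (g $ 1 $ 1) * z + of_real (g $ 1 $ 2)) * of_real (g $ 2 $ 1) = (1 :: complex)"
    by (simp add: algebra_simps)
  then show ?thesis
    unfolding moebius_def[abs_def] autj_def using nz
    by (auto intro!: derivative_eq_intros simp: power2_eq_square)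
qed

lemma moebius_holomorphic: "g \<in> carrier SL2R \<Longrightarrow> moebius g holomorphic_on \<H>"
  using moebius_has_field_derivative open_upper_half_plane
  by (auto simp: holomorphic_on_open)

lemma inverse_autj_power_holomorphic:
  "g \<in> carrier SL2R \<Longrightarrow> (\<lambda>z. 1 / autj g z ^ m) holomorphic_on \<H>"
  using autj_nonzero by (auto simp: autj_def intro!: holomorphic_intros)

lemma slash_holomorphic:
  assumes "g \<in> carrier SL2R" "f holomorphic_on \<H>"
  shows "slash m f g holomorphic_on \<H>"
proof -
  have "(f \<circ> moebius g) holomorphic_on \<H>"
    using assms moebius_upper_half_plane
    by (intro holomorphic_on_compose_gen[OF moebius_holomorphic]) auto
  then have "(\<lambda>z. f (moebius g z) * (1 / autj g z ^ m)) holomorphic_on \<H>"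
    by (intro holomorphic_intros inverse_autj_power_holomorphic assms) (simp add: o_def)
  then show ?thesis by (simp add: slash_def[abs_def])
qed

lemma prod_weights:
  fixes x :: complex
  shows "(\<Prod>i<k. 1 / x ^ m * (1 / x ^ 2) ^ i) = 1 / x ^ (k * (m + k - 1))"
proof (induction k)
  case (Suc k)
  have "k * (m + k - 1) + m + 2 * k = Suc k * (m + Suc k - 1)"
    by (cases k) (auto simp: algebra_simps)
  then have "x ^ (Suc k * (m + Suc k - 1)) = x ^ (k * (m + k - 1)) * (x ^ m * x ^ (2 * k))"
    by (simp only: power_add[symmetric] add.assoc)
  with Suc show ?case
    by (simp add: power_divide power_mult[symmetric])
qed simp

text \<open>A Moebius transformation has derivative \<open>j\<^sup>-\<^sup>2\<close>, so the factor of the change of variable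
  is the product of the \<open>j\<^sup>-\<^sup>m \<cdot> j\<^sup>-\<^sup>2\<^sup>i\<close> over \<open>i < k\<close>. This is where the weight \<open>k (m + k - 1)\<close> comes
  from. The identity holds for all of the group \<open>SL\<^sub>2(\<real>)\<close>, hence it serves both for
  modularity and for the passage to a cusp.\<close>

lemma slash_wronskian:
  assumes s: "\<sigma> \<in> carrier SL2R" and f: "\<And>j. j < k \<Longrightarrow> f j holomorphic_on \<H>" and z: "z \<in> \<H>"
  shows "slash (k * (m + k - 1)) (wronskian k f) \<sigma> z = wronskian k (\<lambda>j. slash m (f j) \<sigma>) z"
proof -
  have "wronskian k (\<lambda>j. slash m (f j) \<sigma>) z =
      wronskian k (\<lambda>j z. 1 / autj \<sigma> z ^ m * f j (moebius \<sigma> z)) z"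
    by (simp add: slash_def[abs_def])
  also have "\<dots> =
      (\<Prod>i<k. 1 / autj \<sigma> z ^ m * deriv (moebius \<sigma>) z ^ i) * wronskian k f (moebius \<sigma> z)"
    by (rule wronskian_mult_compose[OF open_upper_half_plane open_upper_half_plane
          inverse_autj_power_holomorphic[OF s] moebius_holomorphic[OF s] _ f z])
      (use moebius_upper_half_plane[OF s] in auto)
  also have "deriv (moebius \<sigma>) z = 1 / autj \<sigma> z ^ 2"
    by (rule DERIV_imp_deriv[OF moebius_has_field_derivative[OF s z]])
  finally show ?thesis
    by (simp only: prod_weights) (simp add: slash_def)
qed

lemma wronskian_modular:
  assumes g: "\<gamma> \<in> carrier SL2R" and f: "\<And>j. j < k \<Longrightarrow> f j holomorphic_on \<H>"
    and mod: "\<And>j w. j < k \<Longrightarrow> w \<in> \<H> \<Longrightarrow> f j (moebius \<gamma> w) = autj \<gamma> w ^ m * f j w"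
    and z: "z \<in> \<H>"
  shows "wronskian k f (moebius \<gamma> z) = autj \<gamma> z ^ (k * (m + k - 1)) * wronskian k f z"
proof -
  have "wronskian k (\<lambda>j. slash m (f j) \<gamma>) z = wronskian k f z"
    by (rule wronskian_cong[OF open_upper_half_plane z])
      (use slash_holomorphic[OF g f] autj_nonzero[OF g] mod in \<open>auto simp: slash_def\<close>)
  then have "slash (k * (m + k - 1)) (wronskian k f) \<gamma> z = wronskian k f z"
    using slash_wronskian[of \<gamma> k f z m] assms by simp
  then show ?thesis
    using autj_nonzero[OF g z] by (simp add: slash_def field_simps)
qed

section \<open>Behaviour at the cusps\<close>

text \<open>The derivation \<open>d/dz\<close> in the local parameter \<open>q = exp (2 \<pi> i z / h)\<close>.\<close>

definition q_deriv :: "real \<Rightarrow> (complex \<Rightarrow> complex) \<Rightarrow> complex \<Rightarrow> complex" where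
  "q_deriv h g q = 2 * of_real pi * \<i> / of_real h * q * deriv g q"

lemma q_deriv_holomorphic:
  assumes "g holomorphic_on ball 0 1"
  shows "(q_deriv h ^^ i) g holomorphic_on ball 0 1"
proof (induction i)
  case (Suc i)
  then have "(\<lambda>q. 2 * of_real pi * \<i> / of_real h * q * deriv ((q_deriv h ^^ i) g) q)
      holomorphic_on ball 0 1"
    by (intro holomorphic_intros) auto
  then show ?case by (simp add: q_deriv_def[abs_def])
qed (use assms in simp)

lemma q_parameter_in_ball:
  assumes "h > 0" "z \<in> \<H>"
  shows "exp (2 * of_real pi * \<i> * z / of_real h) \<in> ball 0 1"
proof -
  have "Re (2 * of_real pi * \<i> * z / of_real h) = - (2 * pi * Im z / h)"
    by simp
  also have "\<dots> < 0"
    using assms by (simp add: upper_half_plane_def)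
  finally show ?thesis by (simp add: norm_exp_eq_Re)
qed

lemma q_expansion_higher_deriv:
  assumes h: "h > 0" and g: "q_expansion F h g"
  shows "q_expansion ((deriv ^^ i) F) h ((q_deriv h ^^ i) g)"
proof -
  have hol: "(q_deriv h ^^ i) g holomorphic_on ball 0 1" for i
    using g by (intro q_deriv_holomorphic) (simp add: q_expansion_def)
  let ?q = "\<lambda>z. exp (2 * of_real pi * \<i> * z / of_real h)"
  have "(deriv ^^ i) F z = (q_deriv h ^^ i) g (?q z)" if "z \<in> \<H>" for z
    using that
  proof (induction i arbitrary: z)
    case 0
    then show ?case using g by (simp add: q_expansion_def)
  next
    case (Suc i)
    have q: "(?q has_field_derivative 2 * of_real pi * \<i> / of_real h * ?q z) (at z)"
      using h by (auto intro!: derivative_eq_intros)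
    have "((q_deriv h ^^ i) g has_field_derivative deriv ((q_deriv h ^^ i) g) (?q z)) (at (?q z))"
      using hol open_ball q_parameter_in_ball[OF h Suc.prems] by (rule holomorphic_derivI)
    from DERIV_chain2[OF this q]
    have "((\<lambda>z. (q_deriv h ^^ i) g (?q z)) has_field_derivative
        (q_deriv h ^^ Suc i) g (?q z)) (at z)"
      by (simp add: q_deriv_def mult_ac)
    then have "((deriv ^^ i) F has_field_derivative (q_deriv h ^^ Suc i) g (?q z)) (at z)"
      by (rule has_field_derivative_transform_within_open[OF _ open_upper_half_plane Suc.prems])
        (simp add: Suc.IH)
    then show ?case by (simp add: DERIV_imp_deriv)
  qed
  then show ?thesis using hol by (simp add: q_expansion_def)
qed

text \<open>In terms of \<open>q\<close> every derivative carries a factor \<open>q\<close>, so at \<open>q = 0\<close> all rows of the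
  Wronskian except the first vanish; for \<open>k \<ge> 2\<close> there is such a row.\<close>

lemma q_expansion_wronskian:
  assumes h: "h > 0" and g: "\<And>j. j < k \<Longrightarrow> q_expansion (F j) h (g j)" and k: "k \<ge> 2"
  shows "\<exists>G. q_expansion (wronskian k F) h G \<and> G 0 = 0"
proof (intro exI conjI)
  define G where
    "G = (\<lambda>q. Determinant.det (Matrix.mat k k (\<lambda>(i, j). (q_deriv h ^^ i) (g j) q)))"
  have exp: "q_expansion ((deriv ^^ i) (F j)) h ((q_deriv h ^^ i) (g j))" if "j < k" for i j
    using h g[OF that] by (rule q_expansion_higher_deriv)
  have "G holomorphic_on ball 0 1"
    unfolding G_def using exp by (intro det_holomorphic) (auto simp: q_expansion_def)
  moreover have "wronskian k F z = G (exp (2 * of_real pi * \<i> * z / of_real h))"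
    if "z \<in> \<H>" for z
    unfolding wronskian_def G_def using exp that
    by (intro arg_cong[of _ _ Determinant.det] cong_mat) (auto simp: q_expansion_def)
  ultimately show "q_expansion (wronskian k F) h G"
    by (simp add: q_expansion_def)
  let ?M = "Matrix.mat k k (\<lambda>(i, j). (q_deriv h ^^ i) (g j) 0)"
  have "Determinant.det ?M = (\<Sum>j<k. ?M $$ (1, j) * cofactor ?M 1 j)"
    using k by (intro laplace_expansion_row) auto
  also have "\<dots> = 0"
    using k by (intro sum.neutral) (simp add: q_deriv_def)
  finally show "G 0 = 0" by (simp add: G_def)
qed

lemma wronskian_vanishes_at_cusp:
  assumes f: "\<And>j. j < k \<Longrightarrow> f j holomorphic_on \<H>" and k: "k \<ge> 2"
    and c: "\<And>j. j < k \<Longrightarrow> holomorphic_at_cusp \<Gamma> m (f j) x"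
  shows "vanishes_at_cusp \<Gamma> (k * (m + k - 1)) (wronskian k f) x"
  unfolding vanishes_at_cusp_def
proof (intro allI impI)
  fix \<sigma> h assume chart: "cusp_chart \<Gamma> x \<sigma> h"
  then have s: "\<sigma> \<in> carrier SL2R" and h: "h > 0"
    by (auto simp: cusp_chart_def)
  have "\<forall>j. \<exists>g. j < k \<longrightarrow> q_expansion (slash m (f j) \<sigma>) h g"
    using c chart unfolding holomorphic_at_cusp_def by blast
  then obtain g where "\<And>j. j < k \<Longrightarrow> q_expansion (slash m (f j) \<sigma>) h (g j)"
    by metis
  from q_expansion_wronskian[of h k "\<lambda>j. slash m (f j) \<sigma>", OF h this k]
  obtain G where "q_expansion (wronskian k (\<lambda>j. slash m (f j) \<sigma>)) h G" "G 0 = 0"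
    by blast
  then show "\<exists>G. q_expansion (slash (k * (m + k - 1)) (wronskian k f) \<sigma>) h G \<and> G 0 = 0"
    using slash_wronskian[OF s f] by (auto simp: q_expansion_def)
qed

section \<open>The Wronskian of modular forms\<close>

theorem proposition1p5:
  fixes \<Gamma> :: "(real^2^2) set" and m k :: nat and f :: "nat \<Rightarrow> complex \<Rightarrow> complex"
  assumes "fuchsian_first_kind \<Gamma>"
    and "m \<ge> 1"
    and "k \<ge> 1"
    and "\<forall>j<k. f j \<in> modular_forms m \<Gamma>"
  shows "(k \<ge> 2 \<longrightarrow> wronskian k f \<in> cusp_forms (k * (m + k - 1)) \<Gamma>) \<and>
    (lin_indep_on \<H> k f \<longrightarrow> (\<exists>z\<in>\<H>. wronskian k f z \<noteq> 0))"
proof (intro conjI impI)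
  have f: "f j holomorphic_on \<H>" if "j < k" for j
    using assms(4) that by (simp add: modular_forms_def)
  have mod: "f j (moebius \<gamma> z) = autj \<gamma> z ^ m * f j z" if "j < k" "\<gamma> \<in> \<Gamma>" "z \<in> \<H>" for j \<gamma> z
    using assms(4) that by (simp add: modular_forms_def)
  have SL: "\<gamma> \<in> carrier SL2R" if "\<gamma> \<in> \<Gamma>" for \<gamma>
    using assms(1) subgroup.subset that by (auto simp: fuchsian_first_kind_def)
  {
    assume k: "k \<ge> 2"
    have vanish: "vanishes_at_cusp \<Gamma> (k * (m + k - 1)) (wronskian k f) x" if "cusp \<Gamma> x" for x
      using assms(4) that
      by (intro wronskian_vanishes_at_cusp f k) (auto simp: modular_forms_def)
    then have "holomorphic_at_cusp \<Gamma> (k * (m + k - 1)) (wronskian k f) x" if "cusp \<Gamma> x" for x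
      using that unfolding vanishes_at_cusp_def holomorphic_at_cusp_def by blast
    then show "wronskian k f \<in> cusp_forms (k * (m + k - 1)) \<Gamma>"
      using vanish wronskian_holomorphic[of \<H> k f, OF open_upper_half_plane f]
        wronskian_modular[OF SL f mod]
      by (simp add: cusp_forms_def modular_forms_def)
  }
  show "\<exists>z\<in>\<H>. wronskian k f z \<noteq> 0" if "lin_indep_on \<H> k f"
  proof (rule wronskian_nonzero_if_lin_indep[OF open_upper_half_plane
        connected_upper_half_plane _ f that])
    have "\<i> \<in> \<H>" by (simp add: upper_half_plane_def)
    then show "\<H> \<noteq> {}" by blast
  qed
qed

end
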